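(* Let $n \ge 1$, let $d \in \mathbb{S}$, and let $X$ and $Y$ be two nonempty polytopes in $\mathbb{R}^n$ with $-X \subset Y$ and $\dim Y = n$. For $x \in X$ let $\lambda^*(x,d) := \max_{y \in Y} \{ \|x+y\| : x+y \in \mathbb{R}^+ d \}$. Then there exists a vertex $v$ of $X$ at which $\min_{x \in X} \lambda^*(x,d)$ is reached, i.e. $\lambda^*(v,d) = \min_{x\in X} \lambda^*(x,d)$.
   Context: A polytope in $\mathbb{R}^n$ is a compact intersection of finitely many half-spaces (so polytopes are convex). $\|\cdot\|$ is the Euclidean norm, $\mathbb{S} = \{x \in \mathbb{R}^n : \|x\| = 1\}$, $\mathbb{R}^+ d = \{\lambda d : \lambda \ge 0\}$, and $-X = \{-x : x \in X\}$. A vertex of a set $X \subset \mathbb{R}^n$ is a point $x \in X$ such that if there are $x_1, x_2 \in X$ and $\lambda \in [0,1]$ with $x = \lambda x_1 + (1-\lambda) x_2$, then $x = x_1 = x_2$; here the case is understood with $\lambda \in (0,1)$, i.e. a vertex is an extreme point (for a polytope, a vertex in the usual sense). The dimension of a polytope is the dimension of its affine hull. *)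

theory Defs
  imports "HOL-Analysis.Analysis"
begin

lemma polytope_iff_compact_polyhedron:
  fixes S :: "(real ^ 'n) set"
  shows "polytope S \<longleftrightarrow> compact S \<and> polyhedron S"
  by (metis compact_imp_bounded polytope_eq_bounded_polyhedron polytope_imp_compact)

definition ray :: "real ^ 'n \<Rightarrow> (real ^ 'n) set" where
  "ray d = {l *\<^sub>R d | l. 0 \<le> l}"

text \<open>\<^term>\<open>Greatest\<close> denotes the maximum of the set when it is attained and is unspecified otherwise.
  Attainment in the intended situation is shown in \<open>lambda_star_attained\<close>.\<close>

definition lambda_star :: "(real ^ 'n) set \<Rightarrow> real ^ 'n \<Rightarrow> real ^ 'n \<Rightarrow> real" where
  "lambda_star Y x d = (GREATEST r. r \<in> {norm (x + y) | y. y \<in> Y \<and> x + y \<in> ray d})"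

lemma closed_ray: "closed (ray d)"
proof (cases "d = 0")
  case True
  then have "ray d = {0}"
    by (auto simp: ray_def)
  then show ?thesis by simp
next
  case False
  have "ray d = {z. norm d *\<^sub>R z = norm z *\<^sub>R d}"
  proof (intro set_eqI iffI)
    fix z assume "z \<in> {z. norm d *\<^sub>R z = norm z *\<^sub>R d}"
    then have "norm d *\<^sub>R z = norm z *\<^sub>R d" by simp
    then have "inverse (norm d) *\<^sub>R norm d *\<^sub>R z = inverse (norm d) *\<^sub>R norm z *\<^sub>R d" by simp
    then have "z = (inverse (norm d) * norm z) *\<^sub>R d"
      using False by simp
    moreover have "0 \<le> inverse (norm d) * norm z" by simp
    ultimately show "z \<in> ray d"
      unfolding ray_def by blast
  qed (auto simp: ray_def)
  moreover have "closed {z. norm d *\<^sub>R z = norm z *\<^sub>R d}"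
    by (intro closed_Collect_eq continuous_intros)
  ultimately show ?thesis by simp
qed

lemma lambda_star_attained:
  fixes Y :: "(real ^ 'n) set"
  assumes "compact Y" "- x \<in> Y"
  shows "\<exists>y\<in>Y. x + y \<in> ray d \<and> lambda_star Y x d = norm (x + y) \<and>
    (\<forall>z\<in>Y. x + z \<in> ray d \<longrightarrow> norm (x + z) \<le> lambda_star Y x d)"
proof -
  let ?K = "Y \<inter> (\<lambda>y. x + y) -` ray d"
  have "closed ((\<lambda>y. x + y) -` ray d)"
    by (intro closed_vimage closed_ray continuous_intros)
  then have "compact ?K"
    using assms(1) by (rule compact_Int_closed[rotated])
  moreover have "0 \<in> ray d"
    unfolding ray_def by (auto intro!: exI[of _ 0])
  then have "?K \<noteq> {}"
    using assms(2) by force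
  moreover have "continuous_on ?K (\<lambda>y. norm (x + y))"
    by (intro continuous_intros)
  ultimately obtain y where y: "y \<in> ?K" and max: "\<forall>z\<in>?K. norm (x + z) \<le> norm (x + y)"
    using continuous_attains_sup by blast
  have "lambda_star Y x d = norm (x + y)"
    unfolding lambda_star_def by (rule Greatest_equality) (use y max in auto)
  then show ?thesis
    using y max by auto
qed

end

theory Submission imports Defs begin

text \<open>The function \<open>x \<mapsto> lambda_star Y x d\<close> is concave on \<open>X\<close>, because a convex combination of
  maximisers for two points is feasible for the convex combination of the points. A concave function
  on the convex hull of finitely many extreme points attains its minimum at one of them.\<close>

text \<open>The coefficient of the unit vector \<open>d\<close> is nonnegative, so the norm recovers
  it; hence norms add along the ray.\<close>

lemma norm_unit_ray:
  assumes "norm d = 1" "z \<in> ray d"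
  shows "z = norm z *\<^sub>R d"
  using assms by (auto simp: ray_def)

lemma lambda_star_concave:
  fixes d :: "real ^ 'n" and X Y :: "(real ^ 'n) set"
  assumes d: "norm d = 1" and X: "convex X" and Y: "compact Y" "convex Y"
    and XY: "uminus ` X \<subseteq> Y"
  shows "convex_on X (\<lambda>x. - lambda_star Y x d)"
proof (intro convex_onI X)
  fix t :: real and x x' assume t: "0 < t" "t < 1" and x: "x \<in> X" "x' \<in> X"
  \<comment> \<open>As \<open>- x\<close> lies in \<open>Y\<close>, the sum 0 is feasible, so the
    maximum is attained.\<close>
  obtain y where y: "y \<in> Y" "x + y \<in> ray d" "lambda_star Y x d = norm (x + y)"
    using lambda_star_attained[OF Y(1)] XY x by blast
  obtain y' where y': "y' \<in> Y" "x' + y' \<in> ray d" "lambda_star Y x' d = norm (x' + y')"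
    using lambda_star_attained[OF Y(1)] XY x by blast
  define w z l where "w = (1 - t) *\<^sub>R x + t *\<^sub>R x'" and "z = (1 - t) *\<^sub>R y + t *\<^sub>R y'"
    and "l = (1 - t) * norm (x + y) + t * norm (x' + y')"
  have "w \<in> X" "z \<in> Y"
    using X Y(2) x y(1) y'(1) t by (auto simp: w_def z_def convex_alt)
  have "w + z = (1 - t) *\<^sub>R (x + y) + t *\<^sub>R (x' + y')"
    by (simp add: w_def z_def algebra_simps)
  \<comment> \<open>The triangle inequality would bound the norm only from above; on the common ray
    the lengths combine with equality.\<close>
  also have "\<dots> = l *\<^sub>R d"
    using norm_unit_ray[OF d y(2)] norm_unit_ray[OF d y'(2)]
    by (metis l_def scaleR_add_left scaleR_scaleR)
  finally have wz: "w + z = l *\<^sub>R d" .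
  have "0 \<le> l"
    using t by (simp add: l_def)
  then have "w + z \<in> ray d" "norm (w + z) = l"
    using d by (auto simp: wz ray_def)
  \<comment> \<open>This makes \<open>lambda_star Y w d\<close> a genuine maximum, for which
    \<open>z\<close> competes with value \<open>l\<close>.\<close>
  moreover have "- w \<in> Y"
    using XY \<open>w \<in> X\<close> by blast
  ultimately have "l \<le> lambda_star Y w d"
    using lambda_star_attained[OF Y(1)] \<open>z \<in> Y\<close> by metis
  then show "- lambda_star Y ((1 - t) *\<^sub>R x + t *\<^sub>R x') d
      \<le> (1 - t) * - lambda_star Y x d + t * - lambda_star Y x' d"
    by (simp add: w_def l_def y(3) y'(3))
qed

theorem theorem1:
  fixes d :: "real ^ 'n" and X Y :: "(real ^ 'n) set"
  assumes "d \<in> sphere 0 1"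
    and "polytope X" and "X \<noteq> {}"
    and "polytope Y" and "Y \<noteq> {}"
    and "uminus ` X \<subseteq> Y"
    and "aff_dim Y = int CARD('n)"
  shows "\<exists>v. v extreme_point_of X \<and> (\<forall>x\<in>X. lambda_star Y v d \<le> lambda_star Y x d)"
proof -
  let ?E = "{v. v extreme_point_of X}" and ?f = "\<lambda>x. lambda_star Y x d"
  have hull: "X = convex hull ?E"
    using assms(2) by (simp add: Krein_Milman_Minkowski polytope_imp_compact polytope_imp_convex)
  \<comment> \<open>Finiteness yields a least value on \<open>?E\<close> without any continuity of
    \<open>lambda_star\<close>.\<close>
  have "finite ?E"
    using assms(2) by (simp add: finite_polyhedron_extreme_points polytope_imp_polyhedron)
  moreover have "?E \<noteq> {}"
    using hull assms(3) by force
  ultimately obtain v where v: "v \<in> ?E" "\<And>u. u \<in> ?E \<Longrightarrow> ?f v \<le> ?f u"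
    using arg_min_if_finite(1) arg_min_least by metis
  have "convex_on X (\<lambda>x. - ?f x)"
    using assms by (intro lambda_star_concave) (auto simp: polytope_imp_compact polytope_imp_convex)
  \<comment> \<open>An upper bound of a convex function on the generators extends to their
    hull.\<close>
  then have "\<forall>x\<in>convex hull ?E. - ?f x \<le> - ?f v"
    using v(2) hull by (intro convex_on_convex_hull_bound) auto
  then show ?thesis
    using v(1) hull by auto
qed

end
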